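(* Let $X=\{x,y\}$ with $x\neq y$ and $E=\{e_1,e_2\}$ with $e_1\neq e_2$, and let $(X,\mathcal{T},E)$ be a soft topological space over $X$. If $(X,\mathcal{T},E)$ is a soft $T_0$-II space, then $(X,\mathcal{T},E)$ is a soft $T_0$-I space.
   Context: Let $X$ be a universe set and $E$ a set of parameters. A soft set $(F,E)$ over $X$ is a mapping $F:E\to\mathcal{P}(X)$. Unions and intersections of soft sets are taken parameterwise: $(F\cup G)(e)=F(e)\cup G(e)$, $(F\cap G)(e)=F(e)\cap G(e)$, and similarly for arbitrary families. $\widetilde{\emptyset}$ and $\widetilde{X}$ denote the soft sets with constant value $\emptyset$ and $X$, respectively. A soft topology on $X$ (with parameter set $E$) is a collection $\mathcal{T}$ of soft sets $(F,E)$ over $X$ which contains $\widetilde{\emptyset}$ and $\widetilde{X}$ and is closed under arbitrary unions and under intersections of two members; $(X,\mathcal{T},E)$ is then called a soft topological space, and members of $\mathcal{T}$ are called soft open sets. For $x\in X$, write $x\,\widehat{\in}\,(F,E)$ if $x\in F(e)$ for all $e\in E$, and $x\,\widehat{\notin}\,(F,E)$ for its negation. For $a\in E$ and $x\in X$, the soft point $P_a^x$ is the soft set with value $\{x\}$ at $a$ and value $\emptyset$ at every other parameter. Write $P_a^x\,\widetilde{\in}\,(F,E)$ if $x\in F(a)$, and $P_a^x\,\widetilde{\notin}\,(F,E)$ for its negation. Two soft points $P_a^x$, $P_b^y$ are different iff $(a,x)\neq(b,y)$. $(X,\mathcal{T},E)$ is a soft $T_0$-I space if for all $x,y\in X$ with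 $x\neq y$ there is a soft open set $(F,E)$ with $x\,\widehat{\in}\,(F,E)$ and $y\,\widehat{\notin}\,(F,E)$, or there is a soft open set $(G,E)$ with $y\,\widehat{\in}\,(G,E)$ and $x\,\widehat{\notin}\,(G,E)$. $(X,\mathcal{T},E)$ is a soft $T_0$-II space if for all soft points $P_a^x\neq P_b^y$ there is a soft open set $(F,E)$ with $P_a^x\,\widetilde{\in}\,(F,E)$ and $P_b^y\,\widetilde{\notin}\,(F,E)$, or there is a soft open set $(G,E)$ with $P_b^y\,\widetilde{\in}\,(G,E)$ and $P_a^x\,\widetilde{\notin}\,(G,E)$. *)

theory Defs
  imports "HOL-Library.FuncSet"
begin

(* A mapping F : E -> P(X) is an element of the extensional function space
   E \<rightarrow>\<^sub>E Pow X, so that equality of soft sets is equality of HOL functions. *)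
definition soft_sets :: "'a set \<Rightarrow> 'e set \<Rightarrow> ('e \<Rightarrow> 'a set) set" where
  "soft_sets X E = (E \<rightarrow>\<^sub>E Pow X)"

definition soft_const :: "'e set \<Rightarrow> 'a set \<Rightarrow> 'e \<Rightarrow> 'a set" where
  "soft_const E A = (\<lambda>e\<in>E. A)"

definition soft_Union :: "'e set \<Rightarrow> ('e \<Rightarrow> 'a set) set \<Rightarrow> 'e \<Rightarrow> 'a set" where
  "soft_Union E \<S> = (\<lambda>e\<in>E. \<Union>F\<in>\<S>. F e)"

definition soft_inter :: "'e set \<Rightarrow> ('e \<Rightarrow> 'a set) \<Rightarrow> ('e \<Rightarrow> 'a set) \<Rightarrow> 'e \<Rightarrow> 'a set" where
  "soft_inter E F G = (\<lambda>e\<in>E. F e \<inter> G e)"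

definition soft_topology :: "'a set \<Rightarrow> ('e \<Rightarrow> 'a set) set \<Rightarrow> 'e set \<Rightarrow> bool" where
  "soft_topology X \<T> E \<longleftrightarrow>
     \<T> \<subseteq> soft_sets X E \<and>
     soft_const E {} \<in> \<T> \<and>
     soft_const E X \<in> \<T> \<and>
     (\<forall>\<S>. \<S> \<subseteq> \<T> \<longrightarrow> soft_Union E \<S> \<in> \<T>) \<and>
     (\<forall>F\<in>\<T>. \<forall>G\<in>\<T>. soft_inter E F G \<in> \<T>)"

definition soft_mem :: "'e set \<Rightarrow> 'a \<Rightarrow> ('e \<Rightarrow> 'a set) \<Rightarrow> bool" where
  "soft_mem E x F \<longleftrightarrow> (\<forall>e\<in>E. x \<in> F e)"

definition soft_point :: "'e set \<Rightarrow> 'e \<Rightarrow> 'a \<Rightarrow> 'e \<Rightarrow> 'a set" where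
  "soft_point E a x = (\<lambda>e\<in>E. if e = a then {x} else {})"

(* Membership of the soft point with parameter a and value x in F. *)
definition soft_point_mem :: "'e \<Rightarrow> 'a \<Rightarrow> ('e \<Rightarrow> 'a set) \<Rightarrow> bool" where
  "soft_point_mem a x F \<longleftrightarrow> x \<in> F a"

lemma soft_point_eq_iff:
  assumes "a \<in> E" "b \<in> E"
  shows "soft_point E a x = soft_point E b y \<longleftrightarrow> (a, x) = (b, y)"
proof
  assume eq: "soft_point E a x = soft_point E b y"
  then have "soft_point E a x a = soft_point E b y a" by (rule fun_cong)
  then have "{x} = (if a = b then {y} else {})"
    using assms by (simp only: soft_point_def restrict_apply' if_True refl)
  then show "(a, x) = (b, y)" by (cases "a = b") simp_all
qed simp

definition soft_T0_I :: "'a set \<Rightarrow> ('e \<Rightarrow> 'a set) set \<Rightarrow> 'e set \<Rightarrow> bool" where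
  "soft_T0_I X \<T> E \<longleftrightarrow>
     (\<forall>x\<in>X. \<forall>y\<in>X. x \<noteq> y \<longrightarrow>
        (\<exists>F\<in>\<T>. soft_mem E x F \<and> \<not> soft_mem E y F) \<or>
        (\<exists>G\<in>\<T>. soft_mem E y G \<and> \<not> soft_mem E x G))"

definition soft_T0_II :: "'a set \<Rightarrow> ('e \<Rightarrow> 'a set) set \<Rightarrow> 'e set \<Rightarrow> bool" where
  "soft_T0_II X \<T> E \<longleftrightarrow>
     (\<forall>a\<in>E. \<forall>b\<in>E. \<forall>x\<in>X. \<forall>y\<in>X. soft_point E a x \<noteq> soft_point E b y \<longrightarrow>
        (\<exists>F\<in>\<T>. soft_point_mem a x F \<and> \<not> soft_point_mem b y F) \<or>
        (\<exists>G\<in>\<T>. soft_point_mem b y G \<and> \<not> soft_point_mem a x G))"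

end

theory Submission
  imports Defs
begin

text \<open>
  View a soft set as a subset of the finite set \<open>E \<times> X\<close> of soft points. A maximal proper
  soft open set \<open>F\<close> misses exactly one soft point \<open>(a, z)\<close>: if it missed two, a soft open
  set separating them could be joined to \<open>F\<close>. When \<open>X\<close> has only two points, \<open>F\<close> then contains
  the point other than \<open>z\<close> at every parameter and fails to contain \<open>z\<close>.
\<close>

lemma soft_topology_union:
  assumes "soft_topology X \<T> E" "F \<in> \<T>" "G \<in> \<T>"
  obtains H where "H \<in> \<T>" "\<And>e. e \<in> E \<Longrightarrow> H e = F e \<union> G e"
proof
  show "soft_Union E {F, G} \<in> \<T>"
    using assms by (simp add: soft_topology_def)
qed (simp add: soft_Union_def)

text \<open>\<open>Sigma E F\<close> is the set of soft points in \<open>F\<close>, so inclusion of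
  soft sets becomes plain inclusion. Finiteness provides a maximal proper soft open set.\<close>

lemma soft_T0_II_open_missing_one_point:
  assumes top: "soft_topology X \<T> E" and T0: "soft_T0_II X \<T> E"
    and fin: "finite X" "finite E" and ne: "X \<noteq> {}" "E \<noteq> {}"
  obtains F a z where "F \<in> \<T>" "a \<in> E" "z \<in> X" "Sigma E F = E \<times> X - {(a, z)}"
proof -
  define \<P> where "\<P> = {Sigma E F |F. F \<in> \<T> \<and> Sigma E F \<subset> E \<times> X}"
  have sub: "Sigma E F \<subseteq> E \<times> X" if "F \<in> \<T>" for F
    using top that unfolding soft_topology_def soft_sets_def by fast
  have "soft_const E {} \<in> \<T>"
    using top by (simp add: soft_topology_def)
  moreover have "Sigma E (soft_const E {}) = {}"
    by (auto simp: soft_const_def)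
  \<comment> \<open>The null soft set is proper because \<open>E \<times> X\<close> is nonempty; it
    gives the family a member to start from.\<close>
  ultimately have "{} \<in> \<P>"
    using ne unfolding \<P>_def by fastforce
  moreover have "\<P> \<subseteq> Pow (E \<times> X)"
    by (auto simp: \<P>_def)
  then have "finite \<P>"
    by (rule finite_subset) (simp add: fin)
  ultimately obtain M where M: "M \<in> \<P>" "\<And>N. N \<in> \<P> \<Longrightarrow> M \<subseteq> N \<Longrightarrow> M = N"
    using finite_has_maximal[of \<P>] by blast
  then obtain F where F: "F \<in> \<T>" "M = Sigma E F" "Sigma E F \<subset> E \<times> X"
    by (auto simp: \<P>_def)
  then obtain a z where az: "a \<in> E" "z \<in> X" "z \<notin> F a"
    by auto
  \<comment> \<open>Joining \<open>G\<close> to \<open>F\<close> adds \<open>p\<close> but still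
    misses \<open>q\<close>, so the union is proper and strictly larger than the maximal
    \<open>F\<close>.\<close>
  have no_sep: False
    if G: "G \<in> \<T>" "p \<in> E \<times> X - Sigma E F" "q \<in> E \<times> X - Sigma E F"
      "p \<in> Sigma E G" "q \<notin> Sigma E G" for G p q
  proof -
    obtain H where H: "H \<in> \<T>" "\<And>e. e \<in> E \<Longrightarrow> H e = F e \<union> G e"
      using soft_topology_union[OF top F(1) G(1)] by blast
    then have un: "Sigma E H = Sigma E F \<union> Sigma E G"
      by auto
    have "Sigma E H \<in> \<P>"
    proof -
      have "q \<in> E \<times> X" "q \<notin> Sigma E H"
        using G(3,5) un by auto
      then have "Sigma E H \<subset> E \<times> X"
        using sub[OF H(1)] by blast
      then show ?thesis
        using H(1) unfolding \<P>_def by blast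
    qed
    then have "Sigma E F = Sigma E H"
      using M(2)[of "Sigma E H"] F(2) un by simp
    then show False
      using un G(2,4) by (metis DiffE UnI2)
  qed
  \<comment> \<open>The separation may go either way; \<open>no_sep\<close> excludes both, with the
    roles of \<open>p\<close> and \<open>q\<close> exchanged.\<close>
  have uniq: "(b, w) = (a, z)" if bw: "b \<in> E" "w \<in> X" "w \<notin> F b" for b w
  proof (rule ccontr)
    assume "(b, w) \<noteq> (a, z)"
    then have "soft_point E b w \<noteq> soft_point E a z"
      using soft_point_eq_iff[of b E a w z] bw(1) az(1) by simp
    then have "(\<exists>G\<in>\<T>. w \<in> G b \<and> z \<notin> G a) \<or> (\<exists>G\<in>\<T>. z \<in> G a \<and> w \<notin> G b)"
      using T0 bw(1,2) az(1,2) unfolding soft_T0_II_def soft_point_mem_def by simp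
    then show False
    proof (elim disjE bexE conjE)
      fix G assume "G \<in> \<T>" "w \<in> G b" "z \<notin> G a"
      then show False
        using no_sep[of G "(b, w)" "(a, z)"] bw az by simp
    next
      fix G assume "G \<in> \<T>" "z \<in> G a" "w \<notin> G b"
      then show False
        using no_sep[of G "(a, z)" "(b, w)"] bw az by simp
    qed
  qed
  have "Sigma E F = E \<times> X - {(a, z)}"
  proof
    show "Sigma E F \<subseteq> E \<times> X - {(a, z)}"
      using sub[OF F(1)] az(3) by blast
    show "E \<times> X - {(a, z)} \<subseteq> Sigma E F"
    proof
      fix p assume "p \<in> E \<times> X - {(a, z)}"
      then show "p \<in> Sigma E F"
        using uniq[of "fst p" "snd p"] by (cases p) auto
    qed
  qed
  then show thesis
    by (rule that[OF F(1) az(1,2)])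
qed

theorem proposition3p2:
  fixes X :: "'a set" and E :: "'e set" and \<T> :: "('e \<Rightarrow> 'a set) set"
    and x y :: 'a and e1 e2 :: 'e
  assumes "X = {x, y}" and "x \<noteq> y"
    and "E = {e1, e2}" and "e1 \<noteq> e2"
    and "soft_topology X \<T> E"
    and "soft_T0_II X \<T> E"
  shows "soft_T0_I X \<T> E"
proof -
  have "finite X" "finite E" "X \<noteq> {}" "E \<noteq> {}"
    using assms by auto
  with assms(5,6) obtain F a z where F: "F \<in> \<T>" "a \<in> E" "z \<in> X"
    and miss: "Sigma E F = E \<times> X - {(a, z)}"
    by (rule soft_T0_II_open_missing_one_point)
  have "\<not> soft_mem E z F"
    using F(2) miss unfolding soft_mem_def by blast
  \<comment> \<open>The only missing soft point lies over \<open>z\<close>, so \<open>w\<close>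
    belongs to \<open>F\<close> at every parameter.\<close>
  moreover have "soft_mem E w F" if "w \<in> X" "w \<noteq> z" for w
    using that miss unfolding soft_mem_def by blast
  \<comment> \<open>Here the two-point hypothesis enters: every pair of distinct points contains
    \<open>z\<close>, so \<open>F\<close> alone separates it, and which of the two is
    \<open>z\<close> selects the disjunct.\<close>
  moreover have "u = z \<or> v = z" if "u \<in> X" "v \<in> X" "u \<noteq> v" for u v
    using that F(3) assms(1) by blast
  ultimately show ?thesis
    using F(1) unfolding soft_T0_I_def by metis
qed

end
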